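(* Let $K\subseteq\mathbb{R}^{n+m}$ be a compact regular partially convex set in $x\in\mathbb{R}^n$, and let $A=\mathcal{C}_{\mathrm{aff}}(K)$ be its associated free order unit module of type $(n,m)$. Then $K$ is isomorphic (as a partially convex set) to the partially convex coordinate state space $K_A\subseteq\mathbb{R}^{n+m}$. Moreover, the canonical evaluation map $$\theta:K\to S_{\mathrm{par}}(A),\qquad \theta(x,y)=(\mathrm{ev}_x,y),\quad \mathrm{ev}_x(f)=f(x,y)\ \ (f\in A),$$ is a fiberwise affine homeomorphism with respect to the intrinsic topology on $S_{\mathrm{par}}(A)$.
   Context: **Partially convex sets.** Write elements of $\mathbb{R}^{n+m}$ as $(x,y)$, $x\in\mathbb{R}^n$, $y\in\mathbb{R}^m$. For $K\subseteq\mathbb{R}^{n+m}$ let $\pi_2(K)=\{y\in\mathbb{R}^m : \exists x\in\mathbb{R}^n,\ (x,y)\in K\}$ and $K_y=\{x\in\mathbb{R}^n : (x,y)\in K\}$. $K$ is partially convex in $x$ if $K_y$ is convex for every $y\in\pi_2(K)$. A closed set $K$ is a *regular partially convex set* if it is partially convex in $x$, $\operatorname{int}(K_y)\ne\emptyset$ (interior in $\mathbb{R}^n$) for all $y\in\pi_2(K)$, and $y\mapsto\operatorname{int}(K_y)$ on $\pi_2(K)$ is lower hemicontinuous: for every $y\in\pi_2(K)$, every sequence $y_k\to y$ in $\pi_2(K)$ and every $x\in\operatorname{int}(K_y)$ there are $x_k\in\operatorname{int}(K_{y_k})$ with $x_k\to x$. Two partially convex sets $K,L\subseteq\mathbb{R}^{n+m}$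 are *isomorphic* if there is a homeomorphism $\Theta:K\to L$ of the form $\Theta(x,y)=(\theta_y(x),\phi(y))$ where $\phi:\pi_2(K)\to\pi_2(L)$ is a homeomorphism and, for every $y\in\pi_2(K)$, $\theta_y:K_y\to L_{\phi(y)}$ is an affine homeomorphism. $\mathcal{C}_{\mathrm{aff}}(K)$ denotes the space of continuous $f:K\to\mathbb{R}$ such that $x\mapsto f(x,y)$ is affine on $K_y$ for each fixed $y$, with pointwise order and order unit the constant function $1$ (so the order unit norm is the supremum norm). **Module structure of $A=\mathcal{C}_{\mathrm{aff}}(K)$.** For compact regular $K$, $A$ is a free order unit module of type $(n,m)$; its multiplicative domain is $\mathcal{M}_A=\{z\in A: z\cdot a\in A\ \forall a\in A\}$ (here the product is the pointwise product of functions on $K$; in general it is the pointwise product on the state space of $A$, in which $A$ embeds by $a\mapsto(\varphi\mapsto\varphi(a))$). $\mathcal{M}_A$ is a commutative real $C^*$-algebra generated as a unital $C^*$-algebra by $m$ elements, identified with $C(Y)$ (real-valued functions), $Y=\pi_2(K)$, embedded as the functions on $K$ depending only on $y$; and $A$ is a free $\mathcal{M}_A$-module of rank $n+1$, having module bases $\{e_0,\dots,e_n\}$ with $e_0=1$ (for instance $1,x_1,\dots,x_n$). **State spaces.** A state on $A$ is a positive linear functional $\Phi:A\to\mathbb{R}$ with $\Phi(1)=1$. For $y\in Y$, a $y$-state is a state $\Phi$ with $\Phi(g\cdot f)=g(y)\Phi(f)$ for all $g\in C(Y)\cong\mathcal{M}_A$, $f\in A$; $S_y(A)$ is the set of $y$-states.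 The partially convex state space is $S_{\mathrm{par}}(A)=\bigcup_{y\in Y}(S_y(A)\times\{y\})\subseteq A^*\times Y$. Its intrinsic topology is given by evaluation: $(\Phi_k,y_k)\to(\Phi,y)$ iff $y_k\to y$ and $\Phi_k(a)\to\Phi(a)$ for every $a\in A$ (weak-* convergence in the first coordinate, convergence in the second). "Fiberwise affine homeomorphism" means a homeomorphism whose restriction to each fiber $K_y\to S_y(A)$ is an affine homeomorphism. **Coordinate state space.** Given a module basis $\{e_0=1,e_1,\dots,e_n\}$ of $A$ over $\mathcal{M}_A$ and a tuple $(g_1,\dots,g_m)$ generating $\mathcal{M}_A\cong C(Y)$ as a unital $C^*$-algebra, $K_A=\{(\Phi(e_1),\dots,\Phi(e_n),g_1(y),\dots,g_m(y)): y\in Y,\ \Phi\in S_y(A)\}\subseteq\mathbb{R}^{n+m}$. The statement about $K_A$ is understood for any such choice of basis and generators. *)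

theory Defs
  imports "HOL-Analysis.Analysis"
begin

section \<open>Partially convex sets\<close>

text \<open>
  A point of $R^{n+m}$ is a pair; the projection of \<open>K\<close> to the second factor is \<open>snd ` K\<close>.
\<close>

definition fiber :: "('a \<times> 'b) set \<Rightarrow> 'b \<Rightarrow> 'a set" where
  "fiber K y = {x. (x, y) \<in> K}"

definition partially_convex :: "('a::euclidean_space \<times> 'b::euclidean_space) set \<Rightarrow> bool" where
  "partially_convex K \<longleftrightarrow> (\<forall>y \<in> snd ` K. convex (fiber K y))"

definition lower_hemicontinuous_on ::
    "'b::euclidean_space set \<Rightarrow> ('b \<Rightarrow> 'a::euclidean_space set) \<Rightarrow> bool" where
  "lower_hemicontinuous_on Y F \<longleftrightarrow>
     (\<forall>y \<in> Y. \<forall>ys. (\<forall>k::nat. ys k \<in> Y) \<and> ys \<longlonglongrightarrow> y \<longrightarrow>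
        (\<forall>x \<in> F y. \<exists>xs. (\<forall>k. xs k \<in> F (ys k)) \<and> xs \<longlonglongrightarrow> x))"

definition regular_partially_convex ::
    "('a::euclidean_space \<times> 'b::euclidean_space) set \<Rightarrow> bool" where
  "regular_partially_convex K \<longleftrightarrow>
     closed K \<and> partially_convex K \<and>
     (\<forall>y \<in> snd ` K. interior (fiber K y) \<noteq> {}) \<and>
     lower_hemicontinuous_on (snd ` K) (\<lambda>y. interior (fiber K y))"

definition affine_map_on ::
    "'a::real_vector set \<Rightarrow> ('a \<Rightarrow> 'c::real_vector) \<Rightarrow> bool" where
  "affine_map_on S f \<longleftrightarrow>
     (\<forall>x \<in> S. \<forall>x' \<in> S. \<forall>t \<in> {0..1}.
        f ((1 - t) *\<^sub>R x + t *\<^sub>R x') = (1 - t) *\<^sub>R f x + t *\<^sub>R f x')"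

definition partially_convex_isomorphic ::
    "('a::euclidean_space \<times> 'b::euclidean_space) set \<Rightarrow>
     ('a \<times> 'b) set \<Rightarrow> bool" where
  "partially_convex_isomorphic K L \<longleftrightarrow>
     partially_convex K \<and> partially_convex L \<and>
     (\<exists>\<theta> \<phi>.
        (\<exists>\<Theta>'. homeomorphism K L (\<lambda>(x, y). (\<theta> y x, \<phi> y)) \<Theta>') \<and>
        (\<exists>\<phi>'. homeomorphism (snd ` K) (snd ` L) \<phi> \<phi>') \<and>
        (\<forall>y \<in> snd ` K.
           affine_map_on (fiber K y) (\<theta> y) \<and>
           (\<exists>\<theta>'. homeomorphism (fiber K y) (fiber L (\<phi> y)) (\<theta> y) \<theta>')))"


section \<open>The order unit module of continuous fiberwise affine functions\<close>

text \<open>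
  A real function on a set \<open>S\<close> is represented by its extension by zero to the whole type.
  Thus equality of functions on \<open>S\<close> is HOL equality, pointwise sums and products need no
  restriction, and the constant function 1 is \<open>indicat_real S\<close>.
\<close>

definition C_real :: "'a::topological_space set \<Rightarrow> ('a \<Rightarrow> real) set" where
  "C_real S = {f. continuous_on S f \<and> (\<forall>z. z \<notin> S \<longrightarrow> f z = 0)}"

definition C_aff ::
    "('a::euclidean_space \<times> 'b::euclidean_space) set \<Rightarrow> ('a \<times> 'b \<Rightarrow> real) set" where
  "C_aff K = {f \<in> C_real K. \<forall>y \<in> snd ` K. affine_map_on (fiber K y) (\<lambda>x. f (x, y))}"

definition mult_domain :: "('a \<Rightarrow> real) set \<Rightarrow> ('a \<Rightarrow> real) set" where
  "mult_domain A = {z \<in> A. \<forall>a \<in> A. (\<lambda>p. z p * a p) \<in> A}"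

definition module_basis ::
    "('a \<Rightarrow> real) set \<Rightarrow> ('a \<Rightarrow> real) set \<Rightarrow> ('i::finite \<Rightarrow> 'a \<Rightarrow> real) \<Rightarrow> bool" where
  "module_basis M A e \<longleftrightarrow>
     (\<forall>i. e i \<in> A) \<and>
     (\<forall>a \<in> A. \<exists>!c. (\<forall>i. c i \<in> M) \<and> a = (\<lambda>p. \<Sum>i\<in>UNIV. c i p * e i p))"

text \<open>Since all functions are real valued, the involution is the identity.\<close>

definition unital_Cstar_subalgebra ::
    "'a::topological_space set \<Rightarrow> ('a \<Rightarrow> real) set \<Rightarrow> bool" where
  "unital_Cstar_subalgebra Y B \<longleftrightarrow>
     B \<subseteq> C_real Y \<and> indicat_real Y \<in> B \<and>
     (\<forall>f \<in> B. \<forall>h \<in> B. (\<lambda>y. f y + h y) \<in> B) \<and>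
     (\<forall>f \<in> B. \<forall>h \<in> B. (\<lambda>y. f y * h y) \<in> B) \<and>
     (\<forall>f \<in> B. \<forall>c. (\<lambda>y. c * f y) \<in> B) \<and>
     (\<forall>b f. (\<forall>k::nat. b k \<in> B) \<and> f \<in> C_real Y \<and> uniform_limit Y b f sequentially
        \<longrightarrow> f \<in> B)"

definition generates_C_real ::
    "'a::topological_space set \<Rightarrow> ('j \<Rightarrow> 'a \<Rightarrow> real) \<Rightarrow> bool" where
  "generates_C_real Y g \<longleftrightarrow>
     (\<forall>j. g j \<in> C_real Y) \<and> unital_Cstar_subalgebra Y hull range g = C_real Y"

text \<open>
  The embedding of real functions on \<open>snd ` K\<close> into the functions on \<open>K\<close> depending only on
  the second coordinate. The lemma below justifies identifying the multiplicative domain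
  of \<open>C_aff K\<close> with \<open>C_real (snd ` K)\<close>.
\<close>

definition pullback :: "('a \<times> 'b) set \<Rightarrow> ('b \<Rightarrow> real) \<Rightarrow> ('a \<times> 'b \<Rightarrow> real)" where
  "pullback K g = (\<lambda>p. if p \<in> K then g (snd p) else 0)"

lemma mult_domain_C_aff:
  fixes K :: "('a::euclidean_space \<times> 'b::euclidean_space) set"
  assumes K: "compact K" and pc: "partially_convex K"
  shows "mult_domain (C_aff K) = pullback K ` C_real (snd ` K)"
proof (intro equalityI subsetI)
  fix z assume z: "z \<in> mult_domain (C_aff K)"
  then have zA: "z \<in> C_aff K" and zzA: "(\<lambda>p. z p * z p) \<in> C_aff K"
    by (auto simp: mult_domain_def)
  have const: "z (x, y) = z (x', y)" if xy: "(x, y) \<in> K" "(x', y) \<in> K" for x x' y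
  proof -
    have y: "y \<in> snd ` K" using xy by force
    have f: "x \<in> fiber K y" "x' \<in> fiber K y" using xy by (auto simp: fiber_def)
    let ?m = "(1 - 1/2) *\<^sub>R x + (1/2::real) *\<^sub>R x'"
    have half: "(1/2::real) \<in> {0..1}" by simp
    have 1: "z (?m, y) = (1 - 1/2) *\<^sub>R z (x, y) + (1/2) *\<^sub>R z (x', y)"
      using zA y f half unfolding C_aff_def affine_map_on_def by blast
    have 2: "z (?m, y) * z (?m, y)
        = (1 - 1/2) *\<^sub>R (z (x, y) * z (x, y)) + (1/2) *\<^sub>R (z (x', y) * z (x', y))"
      using zzA y f half unfolding C_aff_def affine_map_on_def by blast
    have "(z (x, y) - z (x', y))\<^sup>2 = 0"
      using 2 unfolding 1 by (simp add: power2_eq_square algebra_simps)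
    then show ?thesis by simp
  qed
  define g where "g y = (if y \<in> snd ` K then z (SOME x. (x, y) \<in> K, y) else 0)" for y
  have gz: "g y = z (x, y)" if "(x, y) \<in> K" for x y
  proof -
    have "(SOME x. (x, y) \<in> K, y) \<in> K" using that by (rule someI)
    from const[OF this that] show ?thesis
      using image_eqI[of y snd "(x, y)" K] that by (simp add: g_def)
  qed
  have contz: "continuous_on K z" and z0: "\<And>p. p \<notin> K \<Longrightarrow> z p = 0"
    using zA by (auto simp: C_aff_def C_real_def)
  have contg: "continuous_on (snd ` K) g"
  proof -
    have cY: "closed (snd ` K)"
      by (rule compact_imp_closed[OF compact_continuous_image[OF continuous_on_snd[OF continuous_on_id] K]])
    have "closed (g -` B \<inter> snd ` K)" if B: "closed B" for B
    proof -
      have eq: "g -` B \<inter> snd ` K = snd ` (z -` B \<inter> K)"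
      proof (intro equalityI subsetI)
        fix y assume "y \<in> g -` B \<inter> snd ` K"
        then obtain x where "(x, y) \<in> K" "g y \<in> B" by auto
        then have "(x, y) \<in> z -` B \<inter> K" using gz by simp
        then show "y \<in> snd ` (z -` B \<inter> K)" by force
      next
        fix y assume "y \<in> snd ` (z -` B \<inter> K)"
        then obtain x where x: "(x, y) \<in> K" "z (x, y) \<in> B" by auto
        then show "y \<in> g -` B \<inter> snd ` K" using gz[OF x(1)] by force
      qed
      have "closed (z -` B \<inter> K)"
        using contz B continuous_on_closed_vimage[OF compact_imp_closed[OF K], of z] by simp
      from compact_Int_closed[OF K this] have "compact (z -` B \<inter> K)"
        by (simp add: Int_commute Int_left_commute)
      then show ?thesis unfolding eq
        by (rule compact_imp_closed[OF compact_continuous_image[OF continuous_on_snd[OF continuous_on_id]]])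
    qed
    then show ?thesis using cY by (simp add: continuous_on_closed_vimage)
  qed
  have "g \<in> C_real (snd ` K)" using contg by (auto simp: C_real_def g_def)
  moreover have "z = pullback K g"
  proof
    fix p show "z p = pullback K g p"
      using gz[of "fst p" "snd p"] z0[of p] by (simp add: pullback_def)
  qed
  ultimately show "z \<in> pullback K ` C_real (snd ` K)" by blast
next
  fix z assume "z \<in> pullback K ` C_real (snd ` K)"
  then obtain g where z: "z = pullback K g" and g: "g \<in> C_real (snd ` K)" by blast
  have "continuous_on K (\<lambda>p. g (snd p))"
    using g by (intro continuous_on_compose2[of "snd ` K" g K snd] continuous_intros)
      (simp_all add: C_real_def)
  then have cz: "continuous_on K z"
    by (rule continuous_on_eq) (simp add: z pullback_def)
  have conv: "(1 - t) *\<^sub>R x + t *\<^sub>R x' \<in> fiber K y"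
    if "x \<in> fiber K y" "x' \<in> fiber K y" "t \<in> {0..1}" "y \<in> snd ` K" for x x' y and t::real
  proof -
    have "convex (fiber K y)" using pc that unfolding partially_convex_def by blast
    then show ?thesis using that by (simp add: convexD)
  qed
  have aff1: "affine_map_on (fiber K y) (\<lambda>x. z (x, y))" if "y \<in> snd ` K" for y
    unfolding affine_map_on_def
  proof (intro ballI)
    fix x x' and t :: real
    assume f: "x \<in> fiber K y" "x' \<in> fiber K y" and t: "t \<in> {0..1}"
    have "z ((1 - t) *\<^sub>R x + t *\<^sub>R x', y) = g y" "z (x, y) = g y" "z (x', y) = g y"
      using conv[OF f t that] f by (auto simp: z pullback_def fiber_def)
    then show "z ((1 - t) *\<^sub>R x + t *\<^sub>R x', y) = (1 - t) *\<^sub>R z (x, y) + t *\<^sub>R z (x', y)"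
      by (simp add: algebra_simps)
  qed
  have "(\<lambda>p. z p * a p) \<in> C_aff K" if a: "a \<in> C_aff K" for a
  proof -
    have "affine_map_on (fiber K y) (\<lambda>x. z (x, y) * a (x, y))" if y: "y \<in> snd ` K" for y
      unfolding affine_map_on_def
    proof (intro ballI)
      fix x x' and t :: real
      assume f: "x \<in> fiber K y" "x' \<in> fiber K y" and t: "t \<in> {0..1}"
      let ?w = "(1 - t) *\<^sub>R x + t *\<^sub>R x'"
      have aw: "a (?w, y) = (1 - t) *\<^sub>R a (x, y) + t *\<^sub>R a (x', y)"
        using a y f t unfolding C_aff_def affine_map_on_def by blast
      have zg: "z (?w, y) = g y" "z (x, y) = g y" "z (x', y) = g y"
        using conv[OF f t y] f by (auto simp: z pullback_def fiber_def)
      show "z (?w, y) * a (?w, y)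
          = (1 - t) *\<^sub>R (z (x, y) * a (x, y)) + t *\<^sub>R (z (x', y) * a (x', y))"
        unfolding aw zg by (simp add: algebra_simps)
    qed
    then show ?thesis
      using a cz by (simp add: C_aff_def C_real_def continuous_on_mult)
  qed
  moreover have "z \<in> C_aff K"
    using cz aff1 by (auto simp: C_aff_def C_real_def z pullback_def)
  ultimately show "z \<in> mult_domain (C_aff K)" by (simp add: mult_domain_def)
qed


section \<open>State spaces\<close>

text \<open>
  Functionals on \<open>A = C_aff K\<close> are \<open>extensional\<close>, so that functionals agreeing on \<open>A\<close> are equal.
\<close>

definition states ::
    "('a::euclidean_space \<times> 'b::euclidean_space) set \<Rightarrow> (('a \<times> 'b \<Rightarrow> real) \<Rightarrow> real) set" where
  "states K = {\<Phi> \<in> extensional (C_aff K).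
     (\<forall>a \<in> C_aff K. \<forall>b \<in> C_aff K. \<Phi> (\<lambda>p. a p + b p) = \<Phi> a + \<Phi> b) \<and>
     (\<forall>a \<in> C_aff K. \<forall>c. \<Phi> (\<lambda>p. c * a p) = c * \<Phi> a) \<and>
     (\<forall>a \<in> C_aff K. (\<forall>p \<in> K. 0 \<le> a p) \<longrightarrow> 0 \<le> \<Phi> a) \<and>
     \<Phi> (indicat_real K) = 1}"

definition y_states ::
    "('a::euclidean_space \<times> 'b::euclidean_space) set \<Rightarrow> 'b \<Rightarrow>
     (('a \<times> 'b \<Rightarrow> real) \<Rightarrow> real) set" where
  "y_states K y = {\<Phi> \<in> states K. \<forall>g \<in> C_real (snd ` K). \<forall>f \<in> C_aff K.
     \<Phi> (\<lambda>p. pullback K g p * f p) = g y * \<Phi> f}"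

definition S_par ::
    "('a::euclidean_space \<times> 'b::euclidean_space) set \<Rightarrow>
     ((('a \<times> 'b \<Rightarrow> real) \<Rightarrow> real) \<times> 'b) set" where
  "S_par K = (\<Union>y \<in> snd ` K. y_states K y \<times> {y})"

text \<open>
  The weak-* topology is the topology of pointwise convergence on \<open>C_aff K\<close>, i.e. the
  product topology.
\<close>

definition weak_star ::
    "('a::euclidean_space \<times> 'b::euclidean_space) set \<Rightarrow>
     (('a \<times> 'b \<Rightarrow> real) \<Rightarrow> real) topology" where
  "weak_star K = product_topology (\<lambda>_. euclideanreal) (C_aff K)"

definition intrinsic_topology ::
    "('a::euclidean_space \<times> 'b::euclidean_space) set \<Rightarrow>
     ((('a \<times> 'b \<Rightarrow> real) \<Rightarrow> real) \<times> 'b) topology" where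
  "intrinsic_topology K = subtopology (prod_topology (weak_star K) euclidean) (S_par K)"

definition eval_map ::
    "('a::euclidean_space \<times> 'b::euclidean_space) set \<Rightarrow> 'a \<times> 'b \<Rightarrow>
     (('a \<times> 'b \<Rightarrow> real) \<Rightarrow> real) \<times> 'b" where
  "eval_map K = (\<lambda>(x, y). ((\<lambda>f \<in> C_aff K. f (x, y)), y))"

text \<open>The affine structure of the dual of \<open>C_aff K\<close> is pointwise.\<close>

definition fiberwise_affine_homeomorphism ::
    "('a::euclidean_space \<times> 'b::euclidean_space) set \<Rightarrow>
     ('a \<times> 'b \<Rightarrow> (('a \<times> 'b \<Rightarrow> real) \<Rightarrow> real) \<times> 'b) \<Rightarrow> bool" where
  "fiberwise_affine_homeomorphism K h \<longleftrightarrow>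
     homeomorphic_map (top_of_set K) (intrinsic_topology K) h \<and>
     (\<forall>y \<in> snd ` K.
        (\<forall>x \<in> fiber K y. snd (h (x, y)) = y) \<and>
        homeomorphic_map (top_of_set (fiber K y)) (subtopology (weak_star K) (y_states K y))
          (\<lambda>x. fst (h (x, y))) \<and>
        (\<forall>a \<in> C_aff K. affine_map_on (fiber K y) (\<lambda>x. fst (h (x, y)) a)))"

text \<open>
  A basis with \<open>e\<^sub>0 = 1\<close> of a free module of rank \<open>n + 1\<close> is indexed by \<open>'n option\<close>, the
  element \<open>e\<^sub>0\<close> being \<open>e None\<close>.
\<close>

definition coordinate_state_space ::
    "((real ^ 'n) \<times> (real ^ 'm)) set \<Rightarrow>
     ('n option \<Rightarrow> (real ^ 'n) \<times> (real ^ 'm) \<Rightarrow> real) \<Rightarrow> ('m \<Rightarrow> real ^ 'm \<Rightarrow> real) \<Rightarrow>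
     ((real ^ 'n) \<times> (real ^ 'm)) set" where
  "coordinate_state_space K e g =
     {((\<chi> i. \<Phi> (e (Some i))), (\<chi> j. g j y)) | \<Phi> y. y \<in> snd ` K \<and> \<Phi> \<in> y_states K y}"

end

theory Submission
  imports Defs
begin

text \<open>
  Everything rests on the fact that a \<open>y\<close>-state is evaluation at a single point of the fiber
  over \<open>y\<close> (\<open>y_states_eq_evaluations\<close>), and this has two causes.

  The module condition localises: multiplying by a bump function in the base variable that is
  1 at \<open>y\<close> does not change the value of a \<open>y\<close>-state, and by compactness of \<open>K\<close> a function that
  is nonnegative on the fiber over \<open>y\<close> is almost nonnegative on nearby fibers. So a \<open>y\<close>-state is
  positive on functions that are nonnegative on the one fiber (\<open>y_state_nonneg_of_fiber_nonneg\<close>).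

  On that fiber one can then separate. The values of the state \<open>\<Phi>\<close> on the coordinate functions
  form a barycentre \<open>x\<^sub>0\<close>. For \<open>f\<close> in the module the graph of \<open>f\<close> over the fiber is compact and
  convex; a hyperplane strictly separating it from \<open>(x\<^sub>0, \<Phi> f)\<close> would be an element of the module
  that is positive on the fiber and negative under \<open>\<Phi>\<close>. Hence \<open>(x\<^sub>0, \<Phi> f)\<close> lies on the graph,
  which says at once that \<open>x\<^sub>0\<close> is in the fiber and that \<open>\<Phi> f\<close> is the value of \<open>f\<close> there.

  Consequently the evaluation map and the map \<open>(x, y) \<mapsto> (e\<^sub>i (x, y), g\<^sub>j y)\<close> onto the coordinate
  state space are continuous surjections from a compact space to Hausdorff spaces, and only
  injectivity is left. For evaluations it holds because the coordinate functions belong to the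
  module. For the coordinate map, generators of \<open>C(Y)\<close> separate the points of \<open>Y\<close>, and on a fixed
  fiber every element of the module is a combination of the basis with constant coefficients, so
  the basis separates points wherever the coordinate functions do.
\<close>

section \<open>Affine maps and the module of fiberwise affine functions\<close>

lemma affine_map_on_image_convex:
  assumes "convex S" "affine_map_on S F"
  shows "convex (F ` S)"
  unfolding convex_alt
proof (intro ballI allI impI)
  fix u v t assume "u \<in> F ` S" "v \<in> F ` S" and t: "0 \<le> t \<and> t \<le> (1::real)"
  then obtain x x' where x: "x \<in> S" "x' \<in> S" "u = F x" "v = F x'" by blast
  have "(1 - t) *\<^sub>R x + t *\<^sub>R x' \<in> S"
    using assms(1) x t by (simp add: convex_alt)
  moreover have "F ((1 - t) *\<^sub>R x + t *\<^sub>R x') = (1 - t) *\<^sub>R u + t *\<^sub>R v"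
    using assms(2) x t unfolding affine_map_on_def by simp
  ultimately show "(1 - t) *\<^sub>R u + t *\<^sub>R v \<in> F ` S" by (metis imageI)
qed

lemma affine_map_on_Pair_id:
  "affine_map_on S f \<Longrightarrow> affine_map_on S (\<lambda>x. (x, f x))"
  by (auto simp: affine_map_on_def)

lemma affine_map_on_vec:
  assumes "\<And>i. affine_map_on S (f i)"
  shows "affine_map_on S (\<lambda>x. \<chi> i. f i x)"
  using assms by (auto simp: affine_map_on_def vec_eq_iff)

lemma convex_fiber:
  assumes "partially_convex K"
  shows "convex (fiber K y)"
proof (cases "y \<in> snd ` K")
  case False
  then have "fiber K y = {}" by (force simp: fiber_def)
  then show ?thesis by simp
qed (use assms in \<open>unfold partially_convex_def, blast\<close>)

lemma compact_fiber:
  fixes K :: "('a::euclidean_space \<times> 'b::euclidean_space) set"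
  assumes "compact K"
  shows "compact (fiber K y)"
proof -
  have "fiber K y = fst ` (K \<inter> UNIV \<times> {y})" by (force simp: fiber_def)
  moreover have "compact (K \<inter> UNIV \<times> {y})"
    by (intro compact_Int_closed assms closed_Times closed_UNIV closed_singleton)
  ultimately show ?thesis
    by (auto intro!: compact_continuous_image continuous_intros)
qed

lemma C_aff_add:
  assumes "a \<in> C_aff K" "b \<in> C_aff K"
  shows "(\<lambda>p. a p + b p) \<in> C_aff K"
  using assms
  by (auto simp: C_aff_def C_real_def affine_map_on_def algebra_simps intro!: continuous_intros)

lemma C_aff_scale:
  assumes "a \<in> C_aff K"
  shows "(\<lambda>p. c * a p) \<in> C_aff K"
  using assms
  by (auto simp: C_aff_def C_real_def affine_map_on_def distrib_left intro!: continuous_intros)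

lemma C_aff_pullback_mult:
  assumes "compact K" "partially_convex K" "g \<in> C_real (snd ` K)" "f \<in> C_aff K"
  shows "(\<lambda>p. pullback K g p * f p) \<in> C_aff K"
  using mult_domain_C_aff[OF assms(1,2)] assms(3,4) by (auto simp: mult_domain_def)

lemma C_aff_continuous_on_fiber:
  assumes "f \<in> C_aff K"
  shows "continuous_on (fiber K y) (\<lambda>x. f (x, y))"
  using assms
  by (auto simp: C_aff_def C_real_def fiber_def
      intro!: continuous_on_compose2[of K f] continuous_intros)

lemma C_aff_affine_on_fiber:
  assumes "f \<in> C_aff K"
  shows "affine_map_on (fiber K y) (\<lambda>x. f (x, y))"
proof (cases "y \<in> snd ` K")
  case False
  then have "fiber K y = {}" by (force simp: fiber_def)
  then show ?thesis by (simp add: affine_map_on_def)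
qed (use assms in \<open>unfold C_aff_def, blast\<close>)

definition linear_coordinate ::
    "('a::euclidean_space \<times> 'b::euclidean_space) set \<Rightarrow> 'a \<Rightarrow> 'a \<times> 'b \<Rightarrow> real" where
  "linear_coordinate K a = (\<lambda>p. if p \<in> K then a \<bullet> fst p else 0)"

lemma fiberwise_restriction_in_C_aff:
  fixes h :: "'a::euclidean_space \<Rightarrow> real"
  assumes pc: "partially_convex K" and c: "continuous_on UNIV h" and aff: "affine_map_on UNIV h"
  shows "(\<lambda>p. if p \<in> K then h (fst p) else 0) \<in> C_aff K"
proof -
  have "continuous_on K (\<lambda>p. h (fst p))"
    by (intro continuous_on_compose2[OF c] continuous_intros) auto
  then have cont: "continuous_on K (\<lambda>p. if p \<in> K then h (fst p) else 0)"
    by (rule continuous_on_eq) simp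
  have "(1 - t) *\<^sub>R x + t *\<^sub>R x' \<in> fiber K y"
    if "x \<in> fiber K y" "x' \<in> fiber K y" "t \<in> {0..1}" for x x' y t
    using convex_fiber[OF pc, of y] that by (simp add: convex_alt)
  then show ?thesis
    using aff cont by (auto simp: C_aff_def C_real_def affine_map_on_def fiber_def)
qed

lemma linear_coordinate_in_C_aff:
  "partially_convex K \<Longrightarrow> linear_coordinate K a \<in> C_aff K"
  unfolding linear_coordinate_def
  by (rule fiberwise_restriction_in_C_aff)
    (auto simp: affine_map_on_def inner_simps intro!: continuous_intros)

lemma indicator_in_C_aff:
  assumes "partially_convex K"
  shows "indicat_real K \<in> C_aff K"
proof -
  have "indicat_real K = (\<lambda>p. if p \<in> K then (\<lambda>_. 1) (fst p) else 0)"
    by (auto simp: indicator_def)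
  then show ?thesis
    using fiberwise_restriction_in_C_aff[OF assms, of "\<lambda>_. 1"]
    by (simp add: affine_map_on_def)
qed

section \<open>States over a point of the base are evaluations\<close>

text \<open>
  The set where \<open>f\<close> is at most \<open>-\<epsilon>\<close> is compact, and its projection misses \<open>y\<close>.
\<close>

lemma nonneg_on_fiber_imp_almost_nonneg_nearby:
  fixes K :: "('a::euclidean_space \<times> 'b::euclidean_space) set"
  assumes K: "compact K" and f: "continuous_on K f"
    and nn: "\<forall>x \<in> fiber K y. 0 \<le> f (x, y)" and e: "0 < (e::real)"
  obtains d where "0 < d" "\<And>x z. (x, z) \<in> K \<Longrightarrow> dist z y < d \<Longrightarrow> - e < f (x, z)"
proof -
  let ?C = "f -` {..- e} \<inter> K"
  have "closed ?C"
    using f continuous_on_closed_vimage[OF compact_imp_closed[OF K], of f] by simp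
  then have "compact ?C"
    using compact_Int_closed[OF K] by (metis Int_absorb1 inf_le2)
  then have "closed (snd ` ?C)"
    by (intro compact_imp_closed compact_continuous_image continuous_intros)
  moreover have "y \<notin> snd ` ?C" using nn e by (force simp: fiber_def)
  ultimately obtain d where d: "0 < d" "ball y d \<subseteq> - snd ` ?C"
    by (meson ComplI open_Compl open_contains_ball)
  have "- e < f (x, z)" if xz: "(x, z) \<in> K" "dist z y < d" for x z
  proof (rule ccontr)
    assume "\<not> - e < f (x, z)"
    with xz have "(x, z) \<in> ?C" by simp
    then have "z \<in> snd ` ?C" by (metis image_eqI snd_conv)
    moreover have "z \<in> ball y d" using xz by (simp add: dist_commute)
    ultimately show False using d by blast
  qed
  with d that show thesis by blast
qed

lemma bump_in_C_real:
  fixes y :: "'b::metric_space"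
  assumes "0 < d" "y \<in> Y"
  obtains g where "g \<in> C_real Y" "g y = 1" "\<And>z. 0 \<le> g z" "\<And>z. g z \<le> 1"
    "\<And>z. d \<le> dist z y \<Longrightarrow> g z = (0::real)"
proof
  let ?g = "\<lambda>z. if z \<in> Y then max 0 (1 - dist z y / d) else 0"
  have "continuous_on Y (\<lambda>z. max 0 (1 - dist z y / d))"
    by (intro continuous_intros) (use assms in auto)
  then have "continuous_on Y ?g" by (rule continuous_on_eq) simp
  then show "?g \<in> C_real Y" by (simp add: C_real_def)
qed (use assms in \<open>auto simp: field_simps\<close>)

text \<open>
  Localisation: multiplying by a bump function around \<open>y\<close> does not change the value of a
  \<open>y\<close>-state, so only the behaviour of \<open>f\<close> near the fiber over \<open>y\<close> matters.
\<close>

lemma y_state_nonneg_of_fiber_nonneg: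
  fixes K :: "('a::euclidean_space \<times> 'b::euclidean_space) set"
  assumes K: "compact K" and pc: "partially_convex K"
    and y: "y \<in> snd ` K" and \<Phi>: "\<Phi> \<in> y_states K y"
    and f: "f \<in> C_aff K" and nn: "\<forall>x \<in> fiber K y. 0 \<le> f (x, y)"
  shows "0 \<le> \<Phi> f"
proof (rule field_le_epsilon)
  fix e :: real assume e: "0 < e"
  have "continuous_on K f" using f by (simp add: C_aff_def C_real_def)
  then obtain d where d: "0 < d" "\<And>x z. (x, z) \<in> K \<Longrightarrow> dist z y < d \<Longrightarrow> - e < f (x, z)"
    using nonneg_on_fiber_imp_almost_nonneg_nearby[OF K _ nn e] by blast
  obtain g where g: "g \<in> C_real (snd ` K)" "g y = 1" "\<And>z. 0 \<le> g z" "\<And>z. g z \<le> 1"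
      "\<And>z. d \<le> dist z y \<Longrightarrow> g z = 0"
    using bump_in_C_real[OF d(1) y] by blast
  let ?gf = "\<lambda>p. pullback K g p * f p" and ?e = "\<lambda>p. e * indicat_real K p"
  have gf: "?gf \<in> C_aff K" by (rule C_aff_pullback_mult[OF K pc g(1) f])
  have ee: "?e \<in> C_aff K" by (rule C_aff_scale[OF indicator_in_C_aff[OF pc]])
  have "0 \<le> ?gf p + ?e p" if p: "p \<in> K" for p
  proof -
    obtain x z where pxz: "p = (x, z)" by (cases p)
    have "- e \<le> g z * f (x, z)"
    proof (cases "dist z y < d")
      case True
      then have "- e < f (x, z)" using d p pxz by blast
      then have "g z * (- e) \<le> g z * f (x, z)" using g(3) by (intro mult_left_mono) auto
      moreover have "g z * e \<le> 1 * e" using g(4) e by (intro mult_right_mono) auto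
      ultimately show ?thesis by simp
    qed (use g(5) e in auto)
    then show ?thesis using p pxz by (simp add: pullback_def)
  qed
  then have "0 \<le> \<Phi> (\<lambda>p. ?gf p + ?e p)"
    using \<Phi> C_aff_add[OF gf ee] by (simp add: y_states_def states_def)
  also have "\<dots> = \<Phi> ?gf + e * \<Phi> (indicat_real K)"
    using \<Phi> gf ee indicator_in_C_aff[OF pc] by (simp add: y_states_def states_def)
  also have "\<dots> = \<Phi> f + e"
    using \<Phi> g f by (simp add: y_states_def states_def)
  finally show "0 \<le> \<Phi> f + e" .
qed

text \<open>
  The point is the barycentre of \<open>\<Phi>\<close>: the vector that represents the linear functional
  sending \<open>a\<close> to the value of \<open>\<Phi>\<close> at \<open>x \<mapsto> a \<bullet> x\<close>. It is chosen before \<open>f\<close>, and separation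
  is carried out in one more dimension, on the graph of \<open>f\<close>.
\<close>

lemma y_state_is_evaluation:
  fixes K :: "('a::euclidean_space \<times> 'b::euclidean_space) set"
  assumes K: "compact K" and pc: "partially_convex K"
    and y: "y \<in> snd ` K" and \<Phi>: "\<Phi> \<in> y_states K y"
  obtains x where "x \<in> fiber K y" "\<And>f. f \<in> C_aff K \<Longrightarrow> \<Phi> f = f (x, y)"
proof -
  let ?x = "linear_coordinate K" and ?one = "indicat_real K"
  note xA = linear_coordinate_in_C_aff[OF pc] and oneA = indicator_in_C_aff[OF pc]
  have add: "\<Phi> (\<lambda>p. a p + b p) = \<Phi> a + \<Phi> b" if "a \<in> C_aff K" "b \<in> C_aff K" for a b
    using \<Phi> that by (simp add: y_states_def states_def)
  have scale: "\<Phi> (\<lambda>p. c * a p) = c * \<Phi> a" if "a \<in> C_aff K" for a c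
    using \<Phi> that by (simp add: y_states_def states_def)
  have one: "\<Phi> ?one = 1" using \<Phi> by (simp add: y_states_def states_def)
  have "linear (\<lambda>a. \<Phi> (?x a))"
  proof (rule linearI)
    fix a b :: 'a and c :: real
    have "?x (a + b) = (\<lambda>p. ?x a p + ?x b p)" "?x (c *\<^sub>R a) = (\<lambda>p. c * ?x a p)"
      by (auto simp: linear_coordinate_def inner_simps)
    then show "\<Phi> (?x (a + b)) = \<Phi> (?x a) + \<Phi> (?x b)" "\<Phi> (?x (c *\<^sub>R a)) = c *\<^sub>R \<Phi> (?x a)"
      by (simp_all add: add scale xA)
  qed
  then obtain x0 where x0: "\<And>a. \<Phi> (?x a) = a \<bullet> x0"
    using adjoint_works[of "\<lambda>a. \<Phi> (?x a)" _ 1] by (metis inner_real_def mult.right_neutral)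
  have graph: "(x0, \<Phi> f) \<in> (\<lambda>x. (x, f (x, y))) ` fiber K y" (is "_ \<in> ?G")
    if f: "f \<in> C_aff K" for f
  proof (rule ccontr)
    assume "(x0, \<Phi> f) \<notin> ?G"
    moreover have "convex ?G"
      by (intro affine_map_on_image_convex affine_map_on_Pair_id convex_fiber pc
          C_aff_affine_on_fiber f)
    moreover have "closed ?G"
      by (intro compact_imp_closed compact_continuous_image compact_fiber K
          continuous_on_Pair continuous_on_id C_aff_continuous_on_fiber f)
    ultimately obtain w s where ws: "w \<bullet> (x0, \<Phi> f) < s" "\<forall>q \<in> ?G. s < w \<bullet> q"
      using separating_hyperplane_closed_point by blast
    obtain a r where w: "w = (a, r)" by (cases w)
    let ?h = "\<lambda>p. (?x a p + r * f p) + (- s) * ?one p"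
    have h: "(\<lambda>p. ?x a p + r * f p) \<in> C_aff K" "(\<lambda>p. (- s) * ?one p) \<in> C_aff K"
      by (intro C_aff_add C_aff_scale xA oneA f)+
    have "\<forall>x \<in> fiber K y. 0 \<le> ?h (x, y)"
      using ws(2) by (auto simp: w fiber_def linear_coordinate_def less_imp_le)
    then have "0 \<le> \<Phi> ?h"
      by (intro y_state_nonneg_of_fiber_nonneg[OF K pc y \<Phi>] C_aff_add[OF h])
    moreover have "\<Phi> ?h = a \<bullet> x0 + r * \<Phi> f - s"
      unfolding add[OF h] add[OF xA C_aff_scale[OF f]] scale[OF f] scale[OF oneA] x0 one by simp
    ultimately show False using ws(1) by (simp add: w)
  qed
  from graph[OF oneA] have "x0 \<in> fiber K y" by auto
  moreover have "\<Phi> f = f (x0, y)" if "f \<in> C_aff K" for f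
    using graph[OF that] by auto
  ultimately show thesis by (rule that)
qed

lemma evaluation_in_y_states:
  assumes K: "compact K" and pc: "partially_convex K" and x: "x \<in> fiber K y"
  shows "(\<lambda>f \<in> C_aff K. f (x, y)) \<in> y_states K y"
  using x C_aff_pullback_mult[OF K pc] indicator_in_C_aff[OF pc]
  by (auto simp: y_states_def states_def C_aff_add C_aff_scale fiber_def pullback_def)

lemma y_states_eq_evaluations:
  fixes K :: "('a::euclidean_space \<times> 'b::euclidean_space) set"
  assumes K: "compact K" and pc: "partially_convex K" and y: "y \<in> snd ` K"
  shows "y_states K y = (\<lambda>x. \<lambda>f \<in> C_aff K. f (x, y)) ` fiber K y"
proof (intro equalityI subsetI)
  fix \<Phi> assume \<Phi>: "\<Phi> \<in> y_states K y"
  obtain x where x: "x \<in> fiber K y" "\<And>f. f \<in> C_aff K \<Longrightarrow> \<Phi> f = f (x, y)"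
    using y_state_is_evaluation[OF K pc y \<Phi>] by blast
  have "\<Phi> \<in> extensional (C_aff K)" using \<Phi> by (simp add: y_states_def states_def)
  then have "\<Phi> = (\<lambda>f \<in> C_aff K. f (x, y))"
    by (rule extensionalityI) (auto simp: x(2))
  with x(1) show "\<Phi> \<in> (\<lambda>x. \<lambda>f \<in> C_aff K. f (x, y)) ` fiber K y" by blast
qed (use evaluation_in_y_states[OF K pc] in blast)

section \<open>The evaluation map\<close>

text \<open>The linear coordinates already separate the points of a fiber.\<close>

lemma C_aff_separates_fiber:
  assumes pc: "partially_convex K" and x: "x \<in> fiber K y" "x' \<in> fiber K y"
    and eq: "\<And>f. f \<in> C_aff K \<Longrightarrow> f (x, y) = f (x', y)"
  shows "x = x'"
proof (rule euclidean_eqI)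
  fix b
  show "x \<bullet> b = x' \<bullet> b"
    using eq[OF linear_coordinate_in_C_aff[OF pc, of b]] x
    by (simp add: linear_coordinate_def fiber_def inner_commute)
qed

lemma eval_map_eq_iff:
  assumes pc: "partially_convex K" and "(x, y) \<in> K" "(x', y') \<in> K"
  shows "eval_map K (x, y) = eval_map K (x', y') \<longleftrightarrow> (x, y) = (x', y')"
proof
  assume eq: "eval_map K (x, y) = eval_map K (x', y')"
  then have yy: "y = y'" by (simp add: eval_map_def)
  have "f (x, y) = f (x', y)" if "f \<in> C_aff K" for f
    using eq that unfolding eval_map_def yy by (auto dest: restrict_apply' fun_cong[where x = f])
  then show "(x, y) = (x', y')"
    using C_aff_separates_fiber[OF pc, of x y x'] assms yy by (simp add: fiber_def)
qed simp

lemma Hausdorff_weak_star: "Hausdorff_space (weak_star K)"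
  by (simp add: weak_star_def Hausdorff_space_product_topology)

lemma continuous_map_into_weak_star:
  assumes "\<And>f. f \<in> C_aff K \<Longrightarrow> continuous_on S (\<lambda>x. F x f)"
    "\<And>x. x \<in> S \<Longrightarrow> F x \<in> extensional (C_aff K)"
  shows "continuous_map (top_of_set S) (weak_star K) F"
  using assms by (auto simp: weak_star_def continuous_map_componentwise)

lemma homeomorphic_map_eval_map:
  fixes K :: "('a::euclidean_space \<times> 'b::euclidean_space) set"
  assumes K: "compact K" and pc: "partially_convex K"
  shows "homeomorphic_map (top_of_set K) (intrinsic_topology K) (eval_map K)"
proof (rule continuous_imp_homeomorphic_map)
  have im: "eval_map K ` K = S_par K"
  proof -
    have "eval_map K ` K = (\<Union>y \<in> snd ` K. (\<lambda>x. \<lambda>f \<in> C_aff K. f (x, y)) ` fiber K y \<times> {y})"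
      by (force simp: eval_map_def fiber_def)
    also have "\<dots> = S_par K"
      by (simp add: S_par_def y_states_eq_evaluations[OF K pc])
    finally show ?thesis .
  qed
  have "continuous_map (top_of_set K) (prod_topology (weak_star K) euclidean) (eval_map K)"
    unfolding continuous_map_pairwise
  proof
    show "continuous_map (top_of_set K) (weak_star K) (fst \<circ> eval_map K)"
      by (rule continuous_map_into_weak_star)
        (auto simp: eval_map_def case_prod_unfold C_aff_def C_real_def)
    show "continuous_map (top_of_set K) euclidean (snd \<circ> eval_map K)"
      by (auto simp: eval_map_def case_prod_unfold o_def intro!: continuous_intros)
  qed
  then show "continuous_map (top_of_set K) (intrinsic_topology K) (eval_map K)"
    using im by (auto simp: intrinsic_topology_def continuous_map_in_subtopology)
  have "topspace (intrinsic_topology K) = S_par K"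
    by (auto simp: intrinsic_topology_def weak_star_def S_par_def y_states_def states_def
        PiE_UNIV_domain PiE_def)
  then show "eval_map K ` topspace (top_of_set K) = topspace (intrinsic_topology K)"
    using im by simp
  show "inj_on (eval_map K) (topspace (top_of_set K))"
    using eval_map_eq_iff[OF pc] by (auto intro!: inj_onI)
  show "compact_space (top_of_set K)"
    using K by (simp add: compact_space_subtopology)
  show "Hausdorff_space (intrinsic_topology K)"
    by (auto simp: intrinsic_topology_def Hausdorff_weak_star
        intro!: Hausdorff_space_subtopology simp: Hausdorff_space_prod_topology)
qed

lemma homeomorphic_map_eval_map_fiber:
  fixes K :: "('a::euclidean_space \<times> 'b::euclidean_space) set"
  assumes K: "compact K" and pc: "partially_convex K" and y: "y \<in> snd ` K"
  shows "homeomorphic_map (top_of_set (fiber K y)) (subtopology (weak_star K) (y_states K y))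
          (\<lambda>x. fst (eval_map K (x, y)))"
proof (rule continuous_imp_homeomorphic_map)
  have im: "(\<lambda>x. fst (eval_map K (x, y))) ` fiber K y = y_states K y"
    by (simp add: y_states_eq_evaluations[OF assms] eval_map_def)
  have "continuous_map (top_of_set (fiber K y)) (weak_star K) (\<lambda>x. fst (eval_map K (x, y)))"
    by (rule continuous_map_into_weak_star) (auto simp: eval_map_def C_aff_continuous_on_fiber)
  then show "continuous_map (top_of_set (fiber K y)) (subtopology (weak_star K) (y_states K y))
      (\<lambda>x. fst (eval_map K (x, y)))"
    using im by (auto simp: continuous_map_in_subtopology)
  have "topspace (subtopology (weak_star K) (y_states K y)) = y_states K y"
    by (auto simp: weak_star_def y_states_def states_def PiE_def)
  then show "(\<lambda>x. fst (eval_map K (x, y))) ` topspace (top_of_set (fiber K y)) =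
      topspace (subtopology (weak_star K) (y_states K y))"
    using im by simp
  show "inj_on (\<lambda>x. fst (eval_map K (x, y))) (topspace (top_of_set (fiber K y)))"
  proof (rule inj_onI)
    fix x x' assume x: "x \<in> topspace (top_of_set (fiber K y))" "x' \<in> topspace (top_of_set (fiber K y))"
      and "fst (eval_map K (x, y)) = fst (eval_map K (x', y))"
    then have "eval_map K (x, y) = eval_map K (x', y)" by (simp add: eval_map_def)
    then show "x = x'" using eval_map_eq_iff[OF pc] x by (simp add: fiber_def)
  qed
  show "compact_space (top_of_set (fiber K y))"
    using compact_fiber[OF K] by (simp add: compact_space_subtopology)
  show "Hausdorff_space (subtopology (weak_star K) (y_states K y))"
    by (intro Hausdorff_space_subtopology Hausdorff_weak_star)
qed

lemma fiberwise_affine_homeomorphism_eval_map: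
  fixes K :: "('a::euclidean_space \<times> 'b::euclidean_space) set"
  assumes "compact K" "partially_convex K"
  shows "fiberwise_affine_homeomorphism K (eval_map K)"
  using homeomorphic_map_eval_map[OF assms] homeomorphic_map_eval_map_fiber[OF assms]
  by (simp add: fiberwise_affine_homeomorphism_def eval_map_def C_aff_affine_on_fiber)

section \<open>The coordinate state space\<close>

text \<open>
  The functions taking equal values at two given points form a closed unital subalgebra, so
  generators that did not separate the points would generate a proper subalgebra.
\<close>

lemma generators_separate_points:
  fixes Y :: "'b::metric_space set"
  assumes g: "generates_C_real Y g" and y: "y \<in> Y" "y' \<in> Y" and eq: "\<And>j. g j y = g j y'"
  shows "y = y'"
proof -
  let ?B = "{f \<in> C_real Y. f y = f y'}"
  have "unital_Cstar_subalgebra Y ?B"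
    unfolding unital_Cstar_subalgebra_def
  proof (intro conjI ballI allI impI)
    have "continuous_on Y (indicat_real Y)"
      by (rule continuous_on_eq[of Y "\<lambda>_. 1"]) (auto simp: indicator_def)
    then show "indicat_real Y \<in> ?B" using y by (auto simp: C_real_def)
  next
    fix b f assume "(\<forall>k::nat. b k \<in> ?B) \<and> f \<in> C_real Y \<and> uniform_limit Y b f sequentially"
    then have b: "\<And>k. b k y = b k y'" "f \<in> C_real Y" "uniform_limit Y b f sequentially"
      by auto
    have "(\<lambda>k. b k y) \<longlonglongrightarrow> f y" "(\<lambda>k. b k y') \<longlonglongrightarrow> f y'"
      using tendsto_uniform_limitI[OF b(3)] y by auto
    then have "f y = f y'" unfolding b(1) by (rule LIMSEQ_unique)
    with b(2) show "f \<in> ?B" by simp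
  qed (auto simp: C_real_def intro!: continuous_intros)
  moreover have "range g \<subseteq> ?B" using g eq by (auto simp: generates_C_real_def)
  ultimately have sub: "C_real Y \<subseteq> ?B"
    using g hull_minimal[of "range g" ?B "unital_Cstar_subalgebra Y"]
    by (simp add: generates_C_real_def)
  show ?thesis
  proof (rule ccontr)
    assume "y \<noteq> y'"
    then obtain h where "h \<in> C_real Y" "h y = 1" "h y' = (0::real)"
      using bump_in_C_real[of "dist y' y" y Y] y by (metis dist_commute order_refl zero_less_dist_iff)
    then show False using sub by auto
  qed
qed

text \<open>
  On one fiber the coefficients of an expansion in a module basis are constant. So two points
  of a fiber on which the basis agrees cannot be told apart by any element of the module.
\<close>

lemma module_basis_separates_fiber:
  fixes K :: "('a::euclidean_space \<times> 'b::euclidean_space) set" and e :: "'i::finite \<Rightarrow> _"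
  assumes K: "compact K" and pc: "partially_convex K"
    and e: "module_basis (mult_domain (C_aff K)) (C_aff K) e"
    and x: "x \<in> fiber K y" "x' \<in> fiber K y" and eq: "\<And>i. e i (x, y) = e i (x', y)"
  shows "x = x'"
proof (rule C_aff_separates_fiber[OF pc x])
  fix f assume "f \<in> C_aff K"
  then obtain c where c: "\<And>i. c i \<in> mult_domain (C_aff K)" "f = (\<lambda>p. \<Sum>i\<in>UNIV. c i p * e i p)"
    using e unfolding module_basis_def by blast
  have "c i (x, y) = c i (x', y)" for i
    using c(1)[of i] x unfolding mult_domain_C_aff[OF K pc] by (auto simp: pullback_def fiber_def)
  then show "f (x, y) = f (x', y)" by (simp add: c(2) eq)
qed

lemma partially_convex_isomorphic_coordinate_state_space:
  fixes K :: "((real ^ 'n) \<times> (real ^ 'm)) set"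
    and e :: "'n option \<Rightarrow> (real ^ 'n) \<times> (real ^ 'm) \<Rightarrow> real"
  assumes K: "compact K" and pc: "partially_convex K"
    and e: "module_basis (mult_domain (C_aff K)) (C_aff K) e" "e None = indicat_real K"
    and g: "generates_C_real (snd ` K) g"
  shows "partially_convex_isomorphic K (coordinate_state_space K e g)"
proof -
  define \<theta> where "\<theta> y x = (\<chi> i. e (Some i) (x, y))" for y x
  define \<phi> where "\<phi> y = (\<chi> j. g j y)" for y
  let ?L = "coordinate_state_space K e g" and ?\<Theta> = "\<lambda>(x, y). (\<theta> y x, \<phi> y)"
  have eA: "e i \<in> C_aff K" for i using e(1) by (simp add: module_basis_def)
  have inj\<phi>: "y = y'" if "y \<in> snd ` K" "y' \<in> snd ` K" "\<phi> y = \<phi> y'" for y y'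
    using generators_separate_points[OF g that(1,2)] that(3) by (simp add: \<phi>_def vec_eq_iff)
  have inj\<theta>: "x = x'" if x: "x \<in> fiber K y" "x' \<in> fiber K y" and eq: "\<theta> y x = \<theta> y x'" for x x' y
  proof (rule module_basis_separates_fiber[OF K pc e(1) x])
    fix i
    show "e i (x, y) = e i (x', y)"
      using eq x e(2) by (cases i) (auto simp: \<theta>_def vec_eq_iff fiber_def)
  qed
  have L: "?L = ?\<Theta> ` K"
  proof -
    have "?L = (\<Union>y \<in> snd ` K. (\<lambda>\<Phi>. ((\<chi> i. \<Phi> (e (Some i))), \<phi> y)) ` y_states K y)"
      unfolding coordinate_state_space_def \<phi>_def by blast
    also have "\<dots> = (\<Union>y \<in> snd ` K. (\<lambda>x. (\<theta> y x, \<phi> y)) ` fiber K y)"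
      by (intro SUP_cong refl) (simp add: y_states_eq_evaluations[OF K pc] image_image \<theta>_def eA)
    also have "\<dots> = ?\<Theta> ` K" by (force simp: fiber_def)
    finally show ?thesis .
  qed
  have snd_L: "snd ` ?L = \<phi> ` snd ` K" unfolding L by force
  have fiber_L: "fiber ?L (\<phi> y) = \<theta> y ` fiber K y" if y: "y \<in> snd ` K" for y
  proof (intro equalityI subsetI)
    fix u assume "u \<in> fiber ?L (\<phi> y)"
    then obtain x y' where xy: "(x, y') \<in> K" "u = \<theta> y' x" "\<phi> y = \<phi> y'"
      by (auto simp: fiber_def L)
    then have "y = y'" using inj\<phi>[OF y, of y'] by force
    with xy show "u \<in> \<theta> y ` fiber K y" by (auto simp: fiber_def)
  qed (force simp: fiber_def L)
  have aff: "affine_map_on (fiber K y) (\<theta> y)" for y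
    unfolding \<theta>_def by (intro affine_map_on_vec C_aff_affine_on_fiber eA)
  have pcL: "partially_convex ?L"
    unfolding partially_convex_def snd_L
    by (auto simp: fiber_L intro!: affine_map_on_image_convex convex_fiber[OF pc] aff)
  have cont\<theta>: "continuous_on (fiber K y) (\<theta> y)" for y
    unfolding \<theta>_def by (intro continuous_on_vec_lambda C_aff_continuous_on_fiber eA)
  have cont\<phi>: "continuous_on (snd ` K) \<phi>"
    unfolding \<phi>_def
    by (intro continuous_on_vec_lambda) (use g in \<open>simp add: generates_C_real_def C_real_def\<close>)
  have cont\<Theta>: "continuous_on K ?\<Theta>"
    unfolding case_prod_unfold
  proof (rule continuous_on_Pair)
    show "continuous_on K (\<lambda>p. \<theta> (snd p) (fst p))"
      using eA unfolding \<theta>_def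
      by (intro continuous_on_vec_lambda) (simp add: C_aff_def C_real_def)
    show "continuous_on K (\<lambda>p. \<phi> (snd p))"
      by (rule continuous_on_compose2[OF cont\<phi>]) (auto intro!: continuous_intros)
  qed
  have inj\<Theta>: "inj_on ?\<Theta> K"
  proof (rule inj_onI, clarify)
    fix x y x' y' assume xy: "(x, y) \<in> K" "(x', y') \<in> K" "\<theta> y x = \<theta> y' x'" "\<phi> y = \<phi> y'"
    then have "y = y'" using inj\<phi>[of y y'] by force
    with xy show "x = x' \<and> y = y'" using inj\<theta>[of x y x'] by (simp add: fiber_def)
  qed
  have "compact (snd ` K)" by (intro compact_continuous_image K continuous_intros)
  then have hom\<phi>: "\<exists>\<phi>'. homeomorphism (snd ` K) (snd ` ?L) \<phi> \<phi>'"
    using cont\<phi> snd_L[symmetric] inj_onI[OF inj\<phi>] by (rule homeomorphism_compact)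
  have hom\<theta>: "\<exists>\<theta>'. homeomorphism (fiber K y) (fiber ?L (\<phi> y)) (\<theta> y) \<theta>'" if "y \<in> snd ` K" for y
    using inj\<theta> fiber_L[OF that] cont\<theta>
    by (intro homeomorphism_compact compact_fiber K) (auto intro: inj_onI)
  have hom\<Theta>: "\<exists>\<Theta>'. homeomorphism K ?L ?\<Theta> \<Theta>'"
    by (rule homeomorphism_compact[OF K cont\<Theta> _ inj\<Theta>]) (simp add: L)
  show ?thesis
    unfolding partially_convex_isomorphic_def
    using pc pcL hom\<Theta> hom\<phi> hom\<theta> aff by blast
qed

theorem theorem6p2:
  fixes K :: "((real ^ 'n) \<times> (real ^ 'm)) set"
  assumes "compact K" and "regular_partially_convex K"
  shows "(\<forall>(e :: 'n option \<Rightarrow> (real ^ 'n) \<times> (real ^ 'm) \<Rightarrow> real) (g :: 'm \<Rightarrow> real ^ 'm \<Rightarrow> real).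
            module_basis (mult_domain (C_aff K)) (C_aff K) e \<and> e None = indicat_real K \<and>
            generates_C_real (snd ` K) g \<longrightarrow>
            partially_convex_isomorphic K (coordinate_state_space K e g)) \<and>
         fiberwise_affine_homeomorphism K (eval_map K)"
proof -
  have pc: "partially_convex K" using assms(2) by (simp add: regular_partially_convex_def)
  show ?thesis
    using partially_convex_isomorphic_coordinate_state_space[OF assms(1) pc]
      fiberwise_affine_homeomorphism_eval_map[OF assms(1) pc]
    by blast
qed

end
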